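(* Let $G=(V,E)$ be a finite connected weighted graph with $|V|\ge 2$ and symmetric weight function $w:V\times V\to\mathbb{R}$, with $w_{uv}>0$ if $\{u,v\}\in E$ and $w_{uv}=0$ otherwise. Let $L$ be either the combinatorial Laplacian or the normalized Laplacian of $G$, let $W$ be a real diagonal matrix indexed by $V$, and let $H=L+W$ (a stoquastic matrix). Let $\gamma=\lambda_1-\lambda_0$ be the difference of the two lowest eigenvalues of $H$, and let $h$ be the weighted Cheeger constant of $H$. Then $$2h\ \ge\ \gamma\ \ge\ \sqrt{h^2+Q^2}-Q,$$ where $Q$ is the maximum degree $\max_{u\in V} d_u$ if $L$ is the combinatorial Laplacian, and $Q=1$ if $L$ is the normalized Laplacian.
   Context: The degree of $u$ is $d_u=\sum_v w_{uv}$. The combinatorial Laplacian has entries $L(u,u)=d_u$ and $L(u,v)=-w_{uv}$ for $u\neq v$; the normalized Laplacian is $\mathcal{L}=D^{-1/2}LD^{-1/2}$ with $L$ the combinatorial Laplacian and $D=\mathrm{diag}(d_u)$. Put $q_u=1$ for all $u$ in the combinatorial case and $q_u=d_u$ in the normalized case. Eigenvalues are $\lambda_0\le\lambda_1\le\dots$ counted with multiplicity. The function $\phi\ge 0$, $\phi \not\equiv 0$, denotes the ground-state in the form that solves $$(\lambda_0-W_u)\,q_u\,\phi(u)=\sum_v w_{uv}[\phi(u)-\phi(v)]\qquad (u\in V),$$ i.e. $\phi$ is the lowest eigenvector of $H$ in the combinatorial case and $D^{-1/2}$ times the lowest eigenvector of $H$ in the normalized case. For a nonempty proper subset $S\subset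 V$ with complement $\overline S=V\setminus S$, let $|\partial S|=\sum_{u\in S,\,v\in\overline S} w_{uv}\phi(u)\phi(v)$ and $\mathrm{vol}(S)=\sum_{u\in S}q_u\phi^2(u)$. The weighted Cheeger constant is $$h=\min_{\emptyset\ne S\subsetneq V}\frac{|\partial S|}{\min\{\mathrm{vol}(S),\mathrm{vol}(\overline S)\}}.$$ *)

theory Defs
  imports "HOL-Analysis.Analysis" "HOL-Library.Multiset"
begin

section \<open>Weighted graphs on the vertex set \<open>UNIV :: 'v set\<close>\<close>

text \<open>An edge is an unordered pair of distinct vertices: there are no loops.\<close>

definition simple_graph :: "'v set set \<Rightarrow> bool" where
  "simple_graph E \<longleftrightarrow> (\<forall>e\<in>E. card e = 2)"

definition connected_graph :: "'v set set \<Rightarrow> bool" where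
  "connected_graph E \<longleftrightarrow> (\<forall>u v. (u, v) \<in> {(x, y). {x, y} \<in> E}\<^sup>*)"

definition edge_weights :: "'v set set \<Rightarrow> ('v \<Rightarrow> 'v \<Rightarrow> real) \<Rightarrow> bool" where
  "edge_weights E w \<longleftrightarrow>
     (\<forall>u v. w u v = w v u) \<and>
     (\<forall>u v. {u, v} \<in> E \<longrightarrow> w u v > 0) \<and>
     (\<forall>u v. {u, v} \<notin> E \<longrightarrow> w u v = 0)"

definition wdegree :: "('v::finite \<Rightarrow> 'v \<Rightarrow> real) \<Rightarrow> 'v \<Rightarrow> real" where
  "wdegree w u = (\<Sum>v\<in>UNIV. w u v)"

section \<open>Laplacians\<close>

definition diagonal_matrix :: "real^'v^'v \<Rightarrow> bool" where
  "diagonal_matrix A \<longleftrightarrow> (\<forall>u v. u \<noteq> v \<longrightarrow> A $ u $ v = 0)"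

definition diag :: "('v \<Rightarrow> real) \<Rightarrow> real^'v^'v" where
  "diag f = (\<chi> u v. if u = v then f u else 0)"

definition combinatorial_laplacian :: "('v::finite \<Rightarrow> 'v \<Rightarrow> real) \<Rightarrow> real^'v^'v" where
  "combinatorial_laplacian w = (\<chi> u v. if u = v then wdegree w u else - w u v)"

definition normalized_laplacian :: "('v::finite \<Rightarrow> 'v \<Rightarrow> real) \<Rightarrow> real^'v^'v" where
  "normalized_laplacian w =
     diag (\<lambda>u. 1 / sqrt (wdegree w u)) ** combinatorial_laplacian w **
     diag (\<lambda>u. 1 / sqrt (wdegree w u))"

datatype laplacian_kind = Combinatorial | Normalized

fun laplacian :: "laplacian_kind \<Rightarrow> ('v::finite \<Rightarrow> 'v \<Rightarrow> real) \<Rightarrow> real^'v^'v" where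
  "laplacian Combinatorial w = combinatorial_laplacian w"
| "laplacian Normalized w = normalized_laplacian w"

fun vweight :: "laplacian_kind \<Rightarrow> ('v::finite \<Rightarrow> 'v \<Rightarrow> real) \<Rightarrow> 'v \<Rightarrow> real" where
  "vweight Combinatorial w u = 1"
| "vweight Normalized w u = wdegree w u"

fun degree_bound :: "laplacian_kind \<Rightarrow> ('v::finite \<Rightarrow> 'v \<Rightarrow> real) \<Rightarrow> real" where
  "degree_bound Combinatorial w = Max (range (wdegree w))"
| "degree_bound Normalized w = 1"

section \<open>Eigenvalues in increasing order, with multiplicity\<close>

definition eigenspace :: "real^'v^'v \<Rightarrow> real \<Rightarrow> (real^'v) set" where
  "eigenspace A c = {x. A *v x = c *\<^sub>R x}"

definition spectrum :: "real^'v^'v \<Rightarrow> real set" where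
  "spectrum A = {c. \<exists>x. x \<noteq> 0 \<and> A *v x = c *\<^sub>R x}"

text \<open>
  Multiplicity is the dimension of the eigenspace. The definition is meant for symmetric
  matrices, for which this is also the algebraic multiplicity, so that the list below has
  one entry for each vertex.
\<close>

definition eigenvalue_list :: "real^'v^'v \<Rightarrow> real list" where
  "eigenvalue_list A =
     sorted_list_of_multiset (\<Sum>c\<in>spectrum A. replicate_mset (dim (eigenspace A c)) c)"

definition nth_eigenvalue :: "real^'v^'v \<Rightarrow> nat \<Rightarrow> real" where
  "nth_eigenvalue A k = eigenvalue_list A ! k"

section \<open>Ground state and weighted Cheeger constant\<close>

text \<open>
  In the normalized case \<open>\<phi>\<close> is not itself an eigenvector of \<open>H = L + W\<close>: it is
  \<open>D\<^sup>-\<^sup>1\<^sup>/\<^sup>2\<close> times one.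
\<close>

definition ground_state ::
  "laplacian_kind \<Rightarrow> ('v::finite \<Rightarrow> 'v \<Rightarrow> real) \<Rightarrow> real^'v^'v \<Rightarrow> ('v \<Rightarrow> real) \<Rightarrow> bool" where
  "ground_state k w W \<phi> \<longleftrightarrow>
     (\<forall>u. \<phi> u \<ge> 0) \<and> (\<exists>u. \<phi> u \<noteq> 0) \<and>
     (\<forall>u. (nth_eigenvalue (laplacian k w + W) 0 - W $ u $ u) * vweight k w u * \<phi> u =
          (\<Sum>v\<in>UNIV. w u v * (\<phi> u - \<phi> v)))"

definition boundary_weight ::
  "('v::finite \<Rightarrow> 'v \<Rightarrow> real) \<Rightarrow> ('v \<Rightarrow> real) \<Rightarrow> 'v set \<Rightarrow> real" where
  "boundary_weight w \<phi> S = (\<Sum>u\<in>S. \<Sum>v\<in>- S. w u v * \<phi> u * \<phi> v)"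

definition vol :: "('v::finite \<Rightarrow> real) \<Rightarrow> ('v \<Rightarrow> real) \<Rightarrow> 'v set \<Rightarrow> real" where
  "vol q \<phi> S = (\<Sum>u\<in>S. q u * (\<phi> u)\<^sup>2)"

text \<open>The quotients do not change when \<open>\<phi>\<close> is rescaled, so \<open>\<phi>\<close> is not normalized.\<close>

definition cheeger_constant ::
  "laplacian_kind \<Rightarrow> ('v::finite \<Rightarrow> 'v \<Rightarrow> real) \<Rightarrow> ('v \<Rightarrow> real) \<Rightarrow> real" where
  "cheeger_constant k w \<phi> =
     Min ((\<lambda>S. boundary_weight w \<phi> S /
               min (vol (vweight k w) \<phi> S) (vol (vweight k w) \<phi> (- S)))
          ` {S. S \<noteq> {} \<and> S \<subset> UNIV})"

end

theory Submission
  imports Defs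
begin

text \<open>
  The ground state removes the potential \<open>W\<close> from the problem. It is strictly positive, because the
  graph is connected; put \<open>c u v = w u v * \<phi> u * \<phi> v\<close> and \<open>m u = q u * (\<phi> u)\<^sup>2\<close>. The substitution
  \<open>x u = sqrt (q u) * \<phi> u * f u\<close> then turns the quadratic form of \<open>H - \<lambda>\<^sub>0\<close> into the Dirichlet form of
  the weights \<open>c\<close>, and the squared norm into the squared norm of \<open>f\<close> with respect to the measure \<open>m\<close>
  (\<open>ground_state_transform\<close>). So \<open>\<gamma>\<close> is the least Rayleigh quotient of that form
  over functions of \<open>m\<close>-mean zero, it is attained at an eigenfunction (\<open>spectral_gap_Rayleigh\<close>), and
  \<open>h\<close> is the ordinary Cheeger constant of \<open>c\<close> with respect to \<open>m\<close>.

  The upper bound is the Rayleigh quotient of a centred indicator function (\<open>Cheeger_upper\<close>). For the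
  lower bound let \<open>g\<close> be the positive part of an eigenfunction \<open>f\<close>, with the sign of \<open>f\<close> chosen such that the
  support of \<open>g\<close> has at most half of the volume. Write \<open>N\<close> for the Dirichlet form of \<open>g\<close> and \<open>D\<close> for its squared
  norm, so that \<open>N \<le> \<gamma> * D\<close>. The co-area inequality and the Cauchy-Schwarz inequality give
  \[ (h D)^2 \le N \cdot \frac{1}{2} \sum_{u,v} c_{uv} (g_u + g_v)^2. \]
  The usual next step, \<open>(g u + g v)\<^sup>2 \<le> 2 * (g u)\<^sup>2 + 2 * (g v)\<^sup>2\<close>, would bring in the row sums of \<open>c\<close>,
  which depend on \<open>W\<close> and are not controlled by the degrees. Instead
  \<open>(g u + g v)\<^sup>2 = (g u - g v)\<^sup>2 + 4 * g u * g v\<close>, and in the mixed term \<open>c u v * g u * g v\<close> the ground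
  state is absorbed into \<open>y = \<phi> * g\<close>: it equals \<open>w u v * y u * y v\<close>, whose sum is at most
  \<open>\<Sum>u. d u * (y u)\<^sup>2 \<le> Q * D\<close>. Hence \<open>(h * D)\<^sup>2 \<le> N * (N + 2 * Q * D)\<close>, so that \<open>h\<^sup>2 \<le> \<gamma>\<^sup>2 + 2 * Q * \<gamma>\<close>,
  which is the claimed lower bound.
\<close>

section \<open>Dirichlet forms and the co-area inequality\<close>

definition dirichlet :: "('v::finite \<Rightarrow> 'v \<Rightarrow> real) \<Rightarrow> ('v \<Rightarrow> real) \<Rightarrow> ('v \<Rightarrow> real) \<Rightarrow> real" where
  "dirichlet c f g = (\<Sum>u\<in>UNIV. \<Sum>v\<in>UNIV. c u v * (f u - f v) * (g u - g v)) / 2"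

lemma dirichlet_Green:
  fixes c :: "'v::finite \<Rightarrow> 'v \<Rightarrow> real"
  assumes sym: "\<And>u v. c u v = c v u"
  shows "(\<Sum>u\<in>UNIV. g u * (\<Sum>v\<in>UNIV. c u v * (f u - f v))) = dirichlet c f g"
proof -
  let ?X = "\<Sum>u\<in>UNIV. \<Sum>v\<in>UNIV. g u * (c u v * (f u - f v))"
  have "?X = (\<Sum>v\<in>UNIV. \<Sum>u\<in>UNIV. g u * (c u v * (f u - f v)))"
    by (rule sum.swap)
  also have "\<dots> = (\<Sum>u\<in>UNIV. \<Sum>v\<in>UNIV. g v * (c u v * (f v - f u)))"
    by (simp add: sym)
  finally have "?X + ?X = (\<Sum>u\<in>UNIV. \<Sum>v\<in>UNIV. g u * (c u v * (f u - f v)) + g v * (c u v * (f v - f u)))"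
    by (simp add: sum.distrib)
  also have "\<dots> = 2 * dirichlet c f g"
    unfolding dirichlet_def by (simp add: algebra_simps)
  finally have "?X = dirichlet c f g" by linarith
  thus ?thesis by (simp add: sum_distrib_left)
qed

lemma dirichlet_twice:
  "2 * dirichlet c f g = (\<Sum>u\<in>UNIV. \<Sum>v\<in>UNIV. c u v * (f u - f v) * (g u - g v))"
  by (simp add: dirichlet_def)

lemma dirichlet_nonneg:
  assumes "\<And>u v. 0 \<le> c u v"
  shows "0 \<le> dirichlet c f f"
  unfolding dirichlet_def using assms
  by (auto intro!: divide_nonneg_nonneg sum_nonneg simp: mult.assoc)

lemma dirichlet_eq_0D:
  assumes nn: "\<And>u v. 0 \<le> c u v" and z: "dirichlet c f f = 0" and pos: "c u v > 0"
  shows "f u = f v"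
proof -
  have "(\<Sum>u\<in>UNIV. \<Sum>v\<in>UNIV. c u v * (f u - f v) * (f u - f v)) = 0"
    using z by (simp add: dirichlet_def)
  hence "(\<Sum>v\<in>UNIV. c u v * (f u - f v) * (f u - f v)) = 0"
    by (subst (asm) sum_nonneg_eq_0_iff) (auto intro!: sum_nonneg simp: nn mult.assoc)
  hence "c u v * (f u - f v) * (f u - f v) = 0"
    by (subst (asm) sum_nonneg_eq_0_iff) (auto simp: nn mult.assoc)
  thus ?thesis using pos by simp
qed

text \<open>
  Induction on the support of \<open>s\<close> replaces integration over level sets: subtracting the least positive
  value \<open>a\<close> of \<open>s\<close> on its support \<open>T\<close> lowers the right-hand side by exactly \<open>a\<close> times the cut of \<open>T\<close>,
  lowers the left-hand side by \<open>h * a\<close> times the volume of \<open>T\<close>, and shrinks the support.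
\<close>

lemma coarea_inequality:
  fixes c :: "'v::finite \<Rightarrow> 'v \<Rightarrow> real" and m s :: "'v \<Rightarrow> real"
  assumes cut: "\<And>S. S \<noteq> {} \<Longrightarrow> S \<subseteq> A \<Longrightarrow> h * sum m S \<le> (\<Sum>u\<in>S. \<Sum>v\<in>-S. c u v)"
    and s: "\<And>u. 0 \<le> s u" and supp: "{u. s u \<noteq> 0} \<subseteq> A"
  shows "h * (\<Sum>u\<in>UNIV. m u * s u) \<le> (\<Sum>u\<in>UNIV. \<Sum>v\<in>UNIV. c u v * max 0 (s u - s v))"
  using s supp
proof (induction "card {u. s u \<noteq> 0}" arbitrary: s rule: less_induct)
  case less
  define T where "T = {u. s u \<noteq> 0}"
  show ?case
  proof (cases "T = {}")
    case True
    hence "s u = 0" for u by (auto simp: T_def)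
    thus ?thesis by simp
  next
    case False
    define a where "a = Min (s ` T)"
    have a_in: "a \<in> s ` T" unfolding a_def using False by (intro Min_in) auto
    have a_le: "a \<le> s u" if "u \<in> T" for u unfolding a_def using that by (intro Min_le) auto
    have a_pos: "0 < a" using a_in less.prems(1) by (auto simp: T_def order_less_le)
    define s' where "s' u = s u - a * indicator T u" for u
    have s'_nn: "0 \<le> s' u" for u
      using a_le[of u] less.prems(1)[of u] by (cases "u \<in> T") (auto simp: s'_def)
    obtain u0 where u0: "u0 \<in> T" "s u0 = a" using a_in by auto
    have supp': "{u. s' u \<noteq> 0} \<subseteq> T - {u0}"
      using u0 by (auto simp: s'_def T_def split: split_indicator)
    hence "card {u. s' u \<noteq> 0} < card T"
      using u0 by (intro psubset_card_mono) auto
    hence IH: "h * (\<Sum>u\<in>UNIV. m u * s' u) \<le> (\<Sum>u\<in>UNIV. \<Sum>v\<in>UNIV. c u v * max 0 (s' u - s' v))"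
      using less.hyps[of s'] s'_nn supp' less.prems(2) unfolding T_def by auto
    have T: "h * sum m T \<le> (\<Sum>u\<in>T. \<Sum>v\<in>-T. c u v)"
      using cut False less.prems(2) by (auto simp: T_def)
    have split: "max 0 (s u - s v) = max 0 (s' u - s' v) + a * (indicator T u * indicator (-T) v)" for u v
      using less.prems(1)[of u] less.prems(1)[of v] a_le[of u] a_le[of v] a_pos
      by (auto simp: s'_def T_def split: split_indicator)
    have "(\<Sum>u\<in>UNIV. m u * indicator T u) = sum m T"
      by (simp add: indicator_def if_distrib sum.If_cases)
    moreover have "(\<Sum>u\<in>UNIV. m u * s u) = (\<Sum>u\<in>UNIV. m u * s' u + a * (m u * indicator T u))"
      by (simp add: s'_def algebra_simps)
    ultimately have lhs: "(\<Sum>u\<in>UNIV. m u * s u) = (\<Sum>u\<in>UNIV. m u * s' u) + a * sum m T"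
      by (simp only: sum.distrib sum_distrib_left[symmetric])
    have "(\<Sum>u\<in>UNIV. \<Sum>v\<in>UNIV. c u v * (indicator T u * indicator (-T) v)) =
        (\<Sum>u\<in>UNIV. \<Sum>v\<in>UNIV. if u \<in> T then if v \<in> -T then c u v else 0 else 0)"
      by (intro sum.cong) (auto simp: indicator_def)
    also have "\<dots> = (\<Sum>u\<in>UNIV. if u \<in> T then \<Sum>v\<in>-T. c u v else 0)"
      by (intro sum.cong refl) (simp add: sum.If_cases Compl_eq)
    also have "\<dots> = (\<Sum>u\<in>T. \<Sum>v\<in>-T. c u v)"
      by (simp add: sum.If_cases)
    finally have "(\<Sum>u\<in>UNIV. \<Sum>v\<in>UNIV. c u v * (indicator T u * indicator (-T) v)) =
        (\<Sum>u\<in>T. \<Sum>v\<in>-T. c u v)" .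
    moreover have "(\<Sum>u\<in>UNIV. \<Sum>v\<in>UNIV. c u v * max 0 (s u - s v)) =
        (\<Sum>u\<in>UNIV. \<Sum>v\<in>UNIV. c u v * max 0 (s' u - s' v) +
          a * (c u v * (indicator T u * indicator (-T) v)))"
      by (intro sum.cong refl) (simp add: split distrib_left mult_ac)
    ultimately have rhs: "(\<Sum>u\<in>UNIV. \<Sum>v\<in>UNIV. c u v * max 0 (s u - s v)) =
        (\<Sum>u\<in>UNIV. \<Sum>v\<in>UNIV. c u v * max 0 (s' u - s' v)) + a * (\<Sum>u\<in>T. \<Sum>v\<in>-T. c u v)"
      by (simp only: sum.distrib sum_distrib_left[symmetric])
    have "a * (h * sum m T) \<le> a * (\<Sum>u\<in>T. \<Sum>v\<in>-T. c u v)"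
      using T a_pos by (intro mult_left_mono) auto
    thus ?thesis unfolding lhs rhs using IH by (simp add: algebra_simps)
  qed
qed

section \<open>Cheeger inequalities for a weighted Laplacian\<close>

lemma Cheeger_upper:
  fixes c :: "'v::finite \<Rightarrow> 'v \<Rightarrow> real" and m :: "'v \<Rightarrow> real"
  assumes m: "\<And>u. 0 < m u" and S: "S \<noteq> {}" "S \<noteq> UNIV" and sym: "\<And>u v. c u v = c v u"
    and nn: "\<And>u v. 0 \<le> c u v"
    and Rayleigh: "\<And>f. (\<Sum>u\<in>UNIV. m u * f u) = 0 \<Longrightarrow>
      \<gamma> * (\<Sum>u\<in>UNIV. m u * (f u)\<^sup>2) \<le> dirichlet c f f"
  shows "\<gamma> \<le> 2 * ((\<Sum>u\<in>S. \<Sum>v\<in>-S. c u v) / min (sum m S) (sum m (-S)))"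
proof -
  define a b where "a = sum m S" and "b = sum m (-S)"
  define B where "B = (\<Sum>u\<in>S. \<Sum>v\<in>-S. c u v)"
  have ab: "0 < a" "0 < b"
    unfolding a_def b_def using S m by (auto intro!: sum_pos)
  have B0: "0 \<le> B" unfolding B_def by (intro sum_nonneg nn)
  \<comment> \<open>The indicator of \<open>S\<close> centred at its \<open>m\<close>-mean, scaled by \<open>a + b\<close> to avoid fractions.\<close>
  define f where "f u = (if u \<in> S then b else - a)" for u
  have split: "(\<Sum>u\<in>UNIV. F u) = (\<Sum>u\<in>S. F u) + (\<Sum>u\<in>-S. F u)" for F :: "'v \<Rightarrow> real"
    by (metis Compl_disjoint Compl_partition finite_code sum.union_disjoint)
  have "(\<Sum>u\<in>UNIV. m u * f u) = 0"
    unfolding split by (simp add: f_def a_def b_def flip: sum_distrib_right) (simp add: sum_negf flip: sum_distrib_right)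
  moreover have "(\<Sum>u\<in>UNIV. m u * (f u)\<^sup>2) = a * b * (a + b)"
    unfolding split by (simp add: f_def flip: sum_distrib_right) (simp add: a_def[symmetric] b_def[symmetric] algebra_simps power2_eq_square)
  moreover have "dirichlet c f f = (a + b)\<^sup>2 * B"
  proof -
    have "(\<Sum>u\<in>-S. \<Sum>v\<in>S. c u v) = (\<Sum>v\<in>S. \<Sum>u\<in>-S. c u v)" by (rule sum.swap)
    also have "\<dots> = B" unfolding B_def by (simp add: sym)
    finally have B': "(\<Sum>u\<in>-S. \<Sum>v\<in>S. c u v) = B" .
    have "dirichlet c f f = ((\<Sum>u\<in>S. \<Sum>v\<in>-S. c u v * (a+b)\<^sup>2) + (\<Sum>u\<in>-S. \<Sum>v\<in>S. c u v * (a+b)\<^sup>2)) / 2"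
      unfolding dirichlet_def split
      by (simp add: f_def sum.distrib) (simp add: algebra_simps power2_eq_square)
    also have "\<dots> = (a + b)\<^sup>2 * B"
      by (simp flip: sum_distrib_right add: B' B_def[symmetric])
    finally show ?thesis .
  qed
  ultimately have "\<gamma> * (a * b * (a + b)) \<le> (a + b)\<^sup>2 * B"
    using Rayleigh[of f] by simp
  hence "(a + b) * (\<gamma> * (a * b)) \<le> (a + b) * ((a + b) * B)"
    by (simp add: algebra_simps power2_eq_square)
  hence 1: "\<gamma> * (a * b) \<le> (a + b) * B"
    using ab by (subst (asm) mult_le_cancel_left_pos) auto
  have 2: "a * b = min a b * max a b" by (auto simp: min_def max_def)
  have "\<gamma> * min a b * max a b \<le> (a + b) * B" using 1 2 by (simp add: mult_ac)
  also have "\<dots> \<le> (2 * max a b) * B" using B0 by (intro mult_right_mono) auto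
  finally have "\<gamma> * min a b * max a b \<le> (2 * B) * max a b" by (simp add: mult_ac)
  hence "\<gamma> * min a b \<le> 2 * B"
    using ab by (subst (asm) mult_le_cancel_right_pos) auto
  thus ?thesis unfolding B_def[symmetric] a_def[symmetric] b_def[symmetric]
    using ab by (simp add: field_simps)
qed

text \<open>
  Testing the eigenvalue equation against the positive part of \<open>f\<close> gives the mixed form of \<open>f\<close> and its
  positive part. It dominates the form of the positive part alone, because truncation at 0 is monotone
  and does not increase differences.
\<close>

lemma dirichlet_pos_part:
  fixes c :: "'v::finite \<Rightarrow> 'v \<Rightarrow> real"
  assumes sym: "\<And>u v. c u v = c v u" and nn: "\<And>u v. 0 \<le> c u v"
    and ev: "\<And>u. (\<Sum>v\<in>UNIV. c u v * (f u - f v)) = \<gamma> * m u * f u"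
  shows "dirichlet c (\<lambda>u. max 0 (f u)) (\<lambda>u. max 0 (f u)) \<le> \<gamma> * (\<Sum>u\<in>UNIV. m u * (max 0 (f u))\<^sup>2)"
proof -
  define g where "g u = max 0 (f u)" for u
  have *: "(g u - g v) * (g u - g v) \<le> (f u - f v) * (g u - g v)" for u v
    unfolding g_def max_def by (auto simp: mult_nonneg_nonpos mult_nonpos_nonneg algebra_simps)
  have "dirichlet c g g \<le> dirichlet c f g"
    unfolding dirichlet_def mult.assoc
    by (intro divide_right_mono sum_mono mult_left_mono * nn) auto
  also have "\<dots> = (\<Sum>u\<in>UNIV. g u * (\<gamma> * m u * f u))"
    using dirichlet_Green[of c g f] sym ev by simp
  also have "\<dots> = \<gamma> * (\<Sum>u\<in>UNIV. m u * (g u)\<^sup>2)"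
    unfolding sum_distrib_left by (intro sum.cong) (auto simp: g_def max_def power2_eq_square)
  finally show ?thesis unfolding g_def .
qed

text \<open>
  A bound on the mixed terms \<open>c u v * g u * g v\<close> takes the place of the usual bound on the row sums of
  \<open>c\<close>, which a ground state does not provide. Factoring
  \<open>\<bar>(g u)\<^sup>2 - (g v)\<^sup>2\<bar> = \<bar>g u - g v\<bar> * (g u + g v)\<close> prepares the Cauchy-Schwarz inequality.
\<close>

lemma Cheeger_functional:
  fixes c :: "'v::finite \<Rightarrow> 'v \<Rightarrow> real" and m g :: "'v \<Rightarrow> real"
  assumes sym: "\<And>u v. c u v = c v u" and nn: "\<And>u v. 0 \<le> c u v" and g: "\<And>u. 0 \<le> g u"
    and cut: "\<And>S. S \<noteq> {} \<Longrightarrow> S \<subseteq> {u. g u \<noteq> 0} \<Longrightarrow> h * sum m S \<le> (\<Sum>u\<in>S. \<Sum>v\<in>-S. c u v)"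
    and h: "0 \<le> h" and m: "\<And>u. 0 \<le> m u"
    and Q: "(\<Sum>u\<in>UNIV. \<Sum>v\<in>UNIV. c u v * g u * g v) \<le> Q * (\<Sum>u\<in>UNIV. m u * (g u)\<^sup>2)"
  shows "h\<^sup>2 * (\<Sum>u\<in>UNIV. m u * (g u)\<^sup>2)\<^sup>2 \<le>
    dirichlet c g g * (dirichlet c g g + 2 * Q * (\<Sum>u\<in>UNIV. m u * (g u)\<^sup>2))"
proof -
  define D where "D = (\<Sum>u\<in>UNIV. m u * (g u)\<^sup>2)"
  define N where "N = dirichlet c g g"
  have D0: "0 \<le> D" unfolding D_def using m by (intro sum_nonneg) auto
  have N0: "0 \<le> N" unfolding N_def by (intro dirichlet_nonneg nn)
  \<comment> \<open>The co-area sum sees each edge in the descending direction only; doubling it symmetrizes it.\<close>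
  define P where "P = (\<Sum>u\<in>UNIV. \<Sum>v\<in>UNIV. c u v * max 0 ((g u)\<^sup>2 - (g v)\<^sup>2))"
  have co: "h * D \<le> P"
    unfolding D_def P_def by (rule coarea_inequality[where A="{u. g u \<noteq> 0}"]) (use cut in auto)
  have "P = (\<Sum>v\<in>UNIV. \<Sum>u\<in>UNIV. c u v * max 0 ((g u)\<^sup>2 - (g v)\<^sup>2))"
    unfolding P_def by (rule sum.swap)
  also have "\<dots> = (\<Sum>u\<in>UNIV. \<Sum>v\<in>UNIV. c u v * max 0 ((g v)\<^sup>2 - (g u)\<^sup>2))"
    by (simp add: sym)
  finally have "P + P = (\<Sum>u\<in>UNIV. \<Sum>v\<in>UNIV. c u v * max 0 ((g u)\<^sup>2 - (g v)\<^sup>2) + c u v * max 0 ((g v)\<^sup>2 - (g u)\<^sup>2))"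
    by (simp add: P_def sum.distrib)
  also have "\<dots> = (\<Sum>u\<in>UNIV. \<Sum>v\<in>UNIV. (sqrt (c u v) * \<bar>g u - g v\<bar>) * (sqrt (c u v) * (g u + g v)))"
  proof (intro sum.cong refl)
    fix u v
    have "max 0 ((g u)\<^sup>2 - (g v)\<^sup>2) + max 0 ((g v)\<^sup>2 - (g u)\<^sup>2) = \<bar>(g u)\<^sup>2 - (g v)\<^sup>2\<bar>" by auto
    also have "\<dots> = \<bar>g u - g v\<bar> * (g u + g v)"
      using g[of u] g[of v] by (simp add: power2_eq_square square_diff_square_factored abs_mult mult.commute)
    finally have *: "max 0 ((g u)\<^sup>2 - (g v)\<^sup>2) + max 0 ((g v)\<^sup>2 - (g u)\<^sup>2) = \<bar>g u - g v\<bar> * (g u + g v)" .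
    have "c u v * max 0 ((g u)\<^sup>2 - (g v)\<^sup>2) + c u v * max 0 ((g v)\<^sup>2 - (g u)\<^sup>2) = (sqrt (c u v) * sqrt (c u v)) * (\<bar>g u - g v\<bar> * (g u + g v))"
      using * nn[of u v] by (simp flip: distrib_left)
    thus "c u v * max 0 ((g u)\<^sup>2 - (g v)\<^sup>2) + c u v * max 0 ((g v)\<^sup>2 - (g u)\<^sup>2) =
      (sqrt (c u v) * \<bar>g u - g v\<bar>) * (sqrt (c u v) * (g u + g v))" by (simp only: mult_ac)
  qed
  finally have PP: "2 * P = (\<Sum>(u,v)\<in>UNIV. (sqrt (c u v) * \<bar>g u - g v\<bar>) * (sqrt (c u v) * (g u + g v)))"
    by (simp add: sum.cartesian_product)
  have "(2 * P)\<^sup>2 \<le> (\<Sum>(u,v)\<in>UNIV. (sqrt (c u v) * \<bar>g u - g v\<bar>)\<^sup>2) * (\<Sum>(u,v)\<in>UNIV. (sqrt (c u v) * (g u + g v))\<^sup>2)"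
    using Cauchy_Schwarz_ineq_sum[of "\<lambda>(u, v). sqrt (c u v) * \<bar>g u - g v\<bar>"
      "\<lambda>(u, v). sqrt (c u v) * (g u + g v)" UNIV]
    unfolding PP by (simp add: case_prod_unfold)
  also have "(\<Sum>(u,v)\<in>UNIV. (sqrt (c u v) * \<bar>g u - g v\<bar>)\<^sup>2) = 2 * N"
    unfolding N_def dirichlet_def
    by (simp add: sum.cartesian_product power_mult_distrib nn) (simp add: power2_eq_square mult.assoc)
  also have "(\<Sum>(u,v)\<in>UNIV. (sqrt (c u v) * (g u + g v))\<^sup>2) =
      2 * N + 4 * (\<Sum>u\<in>UNIV. \<Sum>v\<in>UNIV. c u v * g u * g v)"
    unfolding N_def dirichlet_twice
    by (simp add: sum.cartesian_product power_mult_distrib nn sum_distrib_left case_prod_unfold flip: sum.distrib)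
      (intro sum.cong, auto simp: algebra_simps power2_eq_square)
  also have "2 * N * \<dots> \<le> 2 * N * (2 * N + 4 * (Q * D))"
    using Q N0 unfolding D_def by (intro mult_left_mono add_left_mono) auto
  finally have "P\<^sup>2 \<le> N * (N + 2 * Q * D)" by (simp add: power2_eq_square algebra_simps)
  moreover have "(h * D)\<^sup>2 \<le> P\<^sup>2" using co h D0 by (intro power_mono) auto
  ultimately show ?thesis unfolding D_def[symmetric] N_def[symmetric] by (simp add: power_mult_distrib)
qed

text \<open>
  Mean zero makes both \<open>f\<close> and \<open>- f\<close> positive somewhere. The sets where they are positive are
  disjoint, so one of them has at most half of the volume, and the argument runs on that one: for every
  subset of it the minimum in the Cheeger quotient is the volume of the subset.
\<close>

lemma Cheeger_lower:
  fixes c :: "'v::finite \<Rightarrow> 'v \<Rightarrow> real" and m f :: "'v \<Rightarrow> real"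
  assumes sym: "\<And>u v. c u v = c v u" and nn: "\<And>u v. 0 \<le> c u v" and m: "\<And>u. 0 < m u"
    and cut: "\<And>S. S \<noteq> {} \<Longrightarrow> S \<noteq> UNIV \<Longrightarrow>
      h * min (sum m S) (sum m (-S)) \<le> (\<Sum>u\<in>S. \<Sum>v\<in>-S. c u v)"
    and h: "0 \<le> h" and Q0: "0 \<le> Q"
    and Q: "\<And>g. (\<Sum>u\<in>UNIV. \<Sum>v\<in>UNIV. c u v * g u * g v) \<le> Q * (\<Sum>u\<in>UNIV. m u * (g u)\<^sup>2)"
    and ev: "\<And>u. (\<Sum>v\<in>UNIV. c u v * (f u - f v)) = \<gamma> * m u * f u"
    and mean: "(\<Sum>u\<in>UNIV. m u * f u) = 0" and nz: "f u0 \<noteq> 0"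
  shows "h\<^sup>2 \<le> \<gamma> * (\<gamma> + 2 * Q)" "0 \<le> \<gamma>"
proof -
  have main: "h\<^sup>2 \<le> \<gamma> * (\<gamma> + 2 * Q) \<and> 0 \<le> \<gamma>"
    if ev: "\<And>u. (\<Sum>v\<in>UNIV. c u v * (f u - f v)) = \<gamma> * m u * f u"
      and half: "sum m {u. f u > 0} \<le> sum m (- {u. f u > 0})" and pos: "f u1 > 0"
    for f u1
  proof -
    define g where "g u = max 0 (f u)" for u
    define D where "D = (\<Sum>u\<in>UNIV. m u * (g u)\<^sup>2)"
    define N where "N = dirichlet c g g"
    have D: "0 < D" unfolding D_def
      by (rule sum_pos2[where i=u1]) (use m pos in \<open>auto simp: g_def less_imp_le\<close>)
    have N0: "0 \<le> N" unfolding N_def by (intro dirichlet_nonneg nn)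
    have ND: "N \<le> \<gamma> * D" unfolding N_def D_def g_def
      by (rule dirichlet_pos_part) (use sym nn ev in auto)
    have gsupp: "{u. g u \<noteq> 0} = {u. f u > 0}" by (auto simp: g_def max_def)
    have cut': "h * sum m S \<le> (\<Sum>u\<in>S. \<Sum>v\<in>-S. c u v)" if S: "S \<noteq> {}" "S \<subseteq> {u. g u \<noteq> 0}" for S
    proof -
      have a: "sum m S \<le> sum m {u. f u > 0}" using S gsupp m by (intro sum_mono2) (auto simp: less_imp_le)
      have b: "sum m (- {u. f u > 0}) \<le> sum m (-S)" using S gsupp m by (intro sum_mono2) (auto simp: less_imp_le)
      have c: "sum m S \<le> sum m (-S)" using a b half by linarith
      moreover have "0 < sum m S" using S m by (intro sum_pos) auto
      ultimately have "S \<noteq> UNIV" by auto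
      thus ?thesis using cut[of S] S c by (simp add: min_absorb1)
    qed
    have "h\<^sup>2 * D\<^sup>2 \<le> N * (N + 2 * Q * D)" unfolding D_def N_def
      by (rule Cheeger_functional) (use sym nn cut' h m Q in \<open>auto simp: g_def less_imp_le\<close>)
    also have "\<dots> \<le> (\<gamma> * D) * (\<gamma> * D + 2 * Q * D)"
      using N0 ND D Q0 by (intro mult_mono) auto
    also have "\<dots> = (\<gamma> * (\<gamma> + 2 * Q)) * D\<^sup>2" by (simp add: algebra_simps power2_eq_square)
    finally have "h\<^sup>2 \<le> \<gamma> * (\<gamma> + 2 * Q)" using D by simp
    moreover have "0 \<le> \<gamma>" using N0 ND D by (metis order_trans zero_le_mult_iff not_less)
    ultimately show ?thesis by simp
  qed
  have ex_pos: "\<exists>u. f u > 0" if mean: "(\<Sum>u\<in>UNIV. m u * f u) = 0" and nz: "f u0 \<noteq> 0" for f :: "'v \<Rightarrow> real"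
  proof (rule ccontr)
    assume "\<not> ?thesis"
    hence le: "0 \<le> m u * - f u" for u using m[of u] by (simp add: not_less mult_nonneg_nonpos less_imp_le)
    have "(\<Sum>u\<in>UNIV. m u * - f u) = 0" using mean by (simp add: sum_negf)
    hence "m u0 * - f u0 = 0" using le by (subst (asm) sum_nonneg_eq_0_iff) auto
    thus False using nz m[of u0] by simp
  qed
  obtain p where p: "f p > 0" using ex_pos[OF mean nz] by auto
  obtain n where n: "- f n > 0" using ex_pos[of "\<lambda>u. - f u"] mean nz by (auto simp: sum_negf)
  have tot: "sum m S + sum m (-S) = sum m UNIV" for S
    by (metis Compl_disjoint Compl_partition finite_code sum.union_disjoint)
  have "sum m {u. f u > 0} \<le> sum m (- {u. - f u > 0})"
    using m by (intro sum_mono2) (auto simp: less_imp_le)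
  hence "sum m {u. f u > 0} \<le> sum m (- {u. f u > 0}) \<or> sum m {u. - f u > 0} \<le> sum m (- {u. - f u > 0})"
    using tot[of "{u. f u > 0}"] tot[of "{u. - f u > 0}"] by linarith
  moreover have "(\<Sum>v\<in>UNIV. c u v * (- f u - - f v)) = \<gamma> * m u * - f u" for u
  proof -
    have "(\<Sum>v\<in>UNIV. c u v * (- f u - - f v)) = - (\<Sum>v\<in>UNIV. c u v * (f u - f v))"
      by (simp add: algebra_simps flip: sum_negf)
    thus ?thesis using ev[of u] by simp
  qed
  ultimately have "h\<^sup>2 \<le> \<gamma> * (\<gamma> + 2 * Q) \<and> 0 \<le> \<gamma>"
    using main[of f p] main[of "\<lambda>u. - f u" n] p n ev by blast
  thus "h\<^sup>2 \<le> \<gamma> * (\<gamma> + 2 * Q)" "0 \<le> \<gamma>" by auto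
qed

section \<open>The two lowest eigenvalues of a symmetric matrix\<close>

lemma symmetric_matrix_inner:
  fixes A :: "real^'n^'n"
  assumes "transpose A = A"
  shows "x \<bullet> (A *v y) = (A *v x) \<bullet> y"
  by (metis assms dot_lmul_matrix vector_transpose_matrix)

lemma symmetric_eigenvectors_orthogonal:
  fixes A :: "real^'n^'n"
  assumes "transpose A = A" "A *v x = a *\<^sub>R x" "A *v y = b *\<^sub>R y" "a \<noteq> b"
  shows "x \<bullet> y = 0"
  using symmetric_matrix_inner[OF assms(1), of x y] assms by simp

text \<open>
  Needed because an eigenvalue list is a sum over the spectrum, which would collapse to 0 over an
  infinite set. Eigenvectors for distinct eigenvalues are orthogonal, hence independent.
\<close>

lemma finite_spectrum:
  fixes A :: "real^'n^'n"
  assumes "transpose A = A"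
  shows "finite (spectrum A)"
proof -
  have "\<forall>c. \<exists>x. c \<in> spectrum A \<longrightarrow> x \<noteq> 0 \<and> A *v x = c *\<^sub>R x"
    by (auto simp: spectrum_def)
  then obtain e where e: "\<And>c. c \<in> spectrum A \<Longrightarrow> e c \<noteq> 0 \<and> A *v e c = c *\<^sub>R e c"
    by metis
  have orth: "e c \<bullet> e d = 0" if "c \<in> spectrum A" "d \<in> spectrum A" "c \<noteq> d" for c d
    using symmetric_eigenvectors_orthogonal[OF assms] e that by blast
  have inj: "inj_on e (spectrum A)"
    using orth e by (metis inj_onI inner_eq_zero_iff)
  have "pairwise orthogonal (e ` spectrum A)"
    unfolding pairwise_def orthogonal_def using orth by blast
  moreover have "0 \<notin> e ` spectrum A" using e by auto
  ultimately have "independent (e ` spectrum A)" by (rule pairwise_orthogonal_independent)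
  hence "finite (e ` spectrum A)" by (simp add: independent_imp_finite)
  thus ?thesis using inj by (simp add: finite_image_iff)
qed

text \<open>
  A constrained minimizer \<open>y\<close> of the Rayleigh quotient is an eigenvector: the residual
  \<open>z = A y - b y\<close> is itself orthogonal to \<open>p\<close>, so \<open>y\<close> may be varied in the direction \<open>z\<close>, and the
  first-order term of the variation is \<open>z \<bullet> z\<close>. This provides the second eigenvalue
  without diagonalizing \<open>A\<close>.
\<close>

lemma exists_min_eigenvector_orthogonal:
  fixes A :: "real^'n^'n" and p :: "real^'n"
  assumes sym: "transpose A = A" and p: "A *v p = a *\<^sub>R p" and dim: "CARD('n) \<ge> 2"
  obtains b y where "y \<noteq> 0" "A *v y = b *\<^sub>R y" "p \<bullet> y = 0"
    "\<And>x. p \<bullet> x = 0 \<Longrightarrow> b * (x \<bullet> x) \<le> x \<bullet> (A *v x)"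
proof -
  define K where "K = {x. p \<bullet> x = 0} \<inter> sphere 0 1"
  have "compact K" unfolding K_def
    by (intro closed_Int_compact closed_hyperplane compact_sphere)
  moreover have "K \<noteq> {}"
  proof -
    obtain x where x: "x \<noteq> 0" "orthogonal p x"
      using orthogonal_to_vector_exists[of p] dim by auto
    hence "x /\<^sub>R norm x \<in> K" by (auto simp: K_def orthogonal_def)
    thus ?thesis by auto
  qed
  moreover have "continuous_on K (\<lambda>x. x \<bullet> (A *v x))"
    by (intro continuous_intros matrix_vector_mult_linear_continuous_on)
  ultimately obtain y where y: "y \<in> K" and min: "\<And>x. x \<in> K \<Longrightarrow> y \<bullet> (A *v y) \<le> x \<bullet> (A *v x)"
    by (metis continuous_attains_inf)
  define b where "b = y \<bullet> (A *v y)"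
  have yy: "y \<bullet> y = 1" "p \<bullet> y = 0" using y by (auto simp: K_def dot_square_norm)
  have low: "b * (x \<bullet> x) \<le> x \<bullet> (A *v x)" if "p \<bullet> x = 0" for x
  proof (cases "x = 0")
    case False
    hence "x /\<^sub>R norm x \<in> K" using that by (auto simp: K_def)
    from min[OF this] have "b \<le> (x \<bullet> (A *v x)) / (norm x)\<^sup>2"
      by (simp add: b_def matrix_vector_mult_scaleR power2_eq_square field_simps)
    thus ?thesis using False by (simp add: field_simps dot_square_norm)
  qed simp
  define z where "z = A *v y - b *\<^sub>R y"
  have pz: "p \<bullet> z = 0"
    using symmetric_matrix_inner[OF sym, of p y] p yy by (simp add: z_def inner_diff_right)
  have yz: "y \<bullet> z = 0" by (simp add: z_def inner_diff_right b_def[symmetric] yy)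
  have zAy: "z \<bullet> (A *v y) = z \<bullet> z"
    using yz by (simp add: z_def inner_diff_right inner_commute inner_diff_left)
  have yAz: "y \<bullet> (A *v z) = z \<bullet> z"
    using symmetric_matrix_inner[OF sym, of y z] zAy by (simp add: inner_commute)
  have ineq: "0 \<le> 2 * t * (z \<bullet> z) + t\<^sup>2 * (z \<bullet> (A *v z) - b * (z \<bullet> z))" for t
  proof -
    have "b * ((y + t *\<^sub>R z) \<bullet> (y + t *\<^sub>R z)) \<le> (y + t *\<^sub>R z) \<bullet> (A *v (y + t *\<^sub>R z))"
      by (rule low) (simp add: inner_add_right yy pz)
    thus ?thesis using yz zAy yAz yy
      by (simp add: inner_add_left inner_add_right matrix_vector_right_distrib matrix_vector_mult_scaleR
          b_def[symmetric] inner_commute[of z y] algebra_simps power2_eq_square)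
  qed
  have "z = 0"
  proof (rule ccontr)
    assume "z \<noteq> 0"
    define s r where "s = z \<bullet> z" and "r = z \<bullet> (A *v z) - b * (z \<bullet> z)"
    have s: "0 < s" using \<open>z \<noteq> 0\<close> by (simp add: s_def)
    have r: "0 \<le> r" using low[OF pz] by (simp add: r_def)
    \<comment> \<open>Small enough that the negative linear term outweighs the quadratic one.\<close>
    define t where "t = s / (r + s)"
    have t: "0 < t" "t * (r + s) = s" using s r by (simp_all add: t_def)
    have "0 \<le> - 2 * t * s + t * (t * r)"
      using ineq[of "- t"] by (simp add: s_def r_def power2_eq_square mult_ac)
    also have "t * r = s - t * s" using t(2) by (simp add: algebra_simps)
    also have "- 2 * t * s + t * (s - t * s) = - (t * s + t * t * s)" by (simp add: algebra_simps)
    also have "\<dots> < 0" unfolding neg_less_0_iff_less using s t by (intro add_pos_pos mult_pos_pos)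
    finally show False by simp
  qed
  hence "A *v y = b *\<^sub>R y" by (simp add: z_def)
  thus ?thesis using that[of y b] yy low by force
qed

text \<open>
  Simplicity makes \<open>a\<close> occur exactly once in the multiset of eigenvalues. Every other eigenvalue has an
  eigenvector orthogonal to \<open>p\<close> and is therefore at least \<open>b\<close>, so the sorted list starts with \<open>a, b\<close>.
\<close>

lemma nth_eigenvalue_1_eq:
  fixes A :: "real^'n^'n"
  assumes sym: "transpose A = A" and p: "p \<noteq> 0" and simple: "eigenspace A a = span {p}"
    and y: "y \<noteq> 0" "A *v y = b *\<^sub>R y" and ab: "a < b"
    and low: "\<And>x. p \<bullet> x = 0 \<Longrightarrow> b * (x \<bullet> x) \<le> x \<bullet> (A *v x)"
  shows "nth_eigenvalue A 1 = b"
proof -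
  define M where "M = (\<Sum>c\<in>spectrum A. replicate_mset (dim (eigenspace A c)) c)"
  have fin: "finite (spectrum A)" by (rule finite_spectrum[OF sym])
  have cnt: "count M c = (if c \<in> spectrum A then dim (eigenspace A c) else 0)" for c
    unfolding M_def count_sum using fin by (simp add: sum.delta')
  have "p \<in> eigenspace A a" using simple by (simp add: span_base)
  hence pa: "A *v p = a *\<^sub>R p" by (simp add: eigenspace_def)
  have a: "count M a = 1" using pa p simple by (auto simp: cnt spectrum_def)
  have "b \<in> spectrum A" using y by (auto simp: spectrum_def)
  moreover have "dim (eigenspace A b) \<noteq> 0"
    using y by (auto simp: dim_eq_0 eigenspace_def)
  ultimately have b: "b \<in># M" unfolding count_greater_zero_iff[symmetric] cnt by auto
  have other: "b \<le> c" if c: "c \<in># M" "c \<noteq> a" for c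
  proof -
    have "c \<in> spectrum A" using c cnt[of c] by (metis count_eq_zero_iff)
    then obtain x where x: "x \<noteq> 0" "A *v x = c *\<^sub>R x" by (auto simp: spectrum_def)
    have "p \<bullet> x = 0" using symmetric_eigenvectors_orthogonal[OF sym pa x(2)] c by auto
    from low[OF this] x show ?thesis by simp
  qed
  define l where "l = eigenvalue_list A"
  have l: "l = sorted_list_of_multiset M" by (simp add: l_def eigenvalue_list_def M_def)
  have ml: "mset l = M" and sl: "sorted l" by (auto simp: l)
  obtain c l' where cl: "l = c # l'" using b ml by (cases l) auto
  have "a \<in> set l" using a ml by (metis count_eq_zero_iff set_mset_mset zero_neq_one)
  hence ca: "c = a"
  proof -
    have "c \<le> a" using \<open>a \<in> set l\<close> sl cl by auto
    moreover have "c \<in># M" using ml cl by auto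
    ultimately show ?thesis using other[of c] ab by force
  qed
  have l'b: "b \<in> set l'" using b ml cl ca ab by (metis less_irrefl set_ConsD set_mset_mset)
  have nota: "a \<notin> set l'" using a ml cl ca by (auto simp flip: ml simp: count_mset_0_iff count_list_0_iff)
  obtain d l'' where dl: "l' = d # l''" using l'b by (cases l') auto
  have "d \<le> b" using l'b sl cl dl by auto
  moreover have "d \<in># M" "d \<noteq> a" using ml cl dl nota by auto
  ultimately have "d = b" using other[of d] by force
  thus ?thesis by (simp add: nth_eigenvalue_def l_def[symmetric] cl dl)
qed

section \<open>Graphs, positivity and the ground-state transform\<close>

lemma connected_graph_propagate:
  assumes "connected_graph E" and "\<And>u v. {u, v} \<in> E \<Longrightarrow> P u \<Longrightarrow> P v" and "P u"
  shows "P v"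
proof -
  have "(u, v) \<in> {(x, y). {x, y} \<in> E}\<^sup>*" using assms(1) by (auto simp: connected_graph_def)
  thus ?thesis using assms(3) by (induction rule: rtrancl_induct) (use assms(2) in auto)
qed

lemma edge_weights_nonneg: "edge_weights E w \<Longrightarrow> 0 \<le> w u v"
  unfolding edge_weights_def by (metis order_refl less_imp_le)

lemma wdegree_pos:
  fixes w :: "'v::finite \<Rightarrow> 'v \<Rightarrow> real"
  assumes conn: "connected_graph E" and ew: "edge_weights E w" and card: "CARD('v) \<ge> 2"
  shows "0 < wdegree w u"
proof -
  have "\<exists>v. {u, v} \<in> E"
  proof (rule ccontr)
    assume no: "\<not> ?thesis"
    have "v = u" for v
      by (rule connected_graph_propagate[OF conn, of "\<lambda>v. v = u" u]) (use no in auto)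
    hence "(UNIV :: 'v set) = {u}" by blast
    hence "CARD('v) = card {u}" by (rule arg_cong)
    thus False using card by simp
  qed
  then obtain v where "{u, v} \<in> E" by auto
  thus ?thesis unfolding wdegree_def using ew edge_weights_nonneg[OF ew]
    by (intro sum_pos2[where i=v]) (auto simp: edge_weights_def)
qed

text \<open>
  At a zero of \<open>\<phi>\<close> the eigenvalue equation reduces to the vanishing of a sum of nonnegative terms
  \<open>w u v * \<phi> v\<close>. So zeros spread to neighbours, and by connectedness one zero would force \<open>\<phi> = 0\<close>.
\<close>

lemma ground_state_pos:
  fixes w :: "'v::finite \<Rightarrow> 'v \<Rightarrow> real"
  assumes conn: "connected_graph E" and ew: "edge_weights E w" and gs: "ground_state k w W \<phi>"
  shows "0 < \<phi> u"
proof (rule ccontr)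
  have nn: "0 \<le> \<phi> u" for u using gs by (simp add: ground_state_def)
  assume "\<not> ?thesis"
  hence u: "\<phi> u = 0" using nn[of u] by simp
  have "\<phi> v = 0" for v
  proof (rule connected_graph_propagate[OF conn, of "\<lambda>v. \<phi> v = 0", OF _ u])
    fix a b assume ab: "{a, b} \<in> E" "\<phi> a = 0"
    have "0 = (\<Sum>v\<in>UNIV. w a v * (\<phi> a - \<phi> v))"
      using gs[unfolded ground_state_def, THEN conjunct2, THEN conjunct2, THEN spec, of a] ab(2) by simp
    hence "(\<Sum>v\<in>UNIV. w a v * \<phi> v) = 0" using ab by (simp add: sum_negf)
    hence "w a b * \<phi> b = 0"
      using nn edge_weights_nonneg[OF ew] by (subst (asm) sum_nonneg_eq_0_iff) auto
    moreover have "0 < w a b" using ew ab by (auto simp: edge_weights_def)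
    ultimately show "\<phi> b = 0" by simp
  qed
  thus False using gs by (auto simp: ground_state_def)
qed

lemma diag_mult_mult_diag:
  "(diag f ** A ** diag g) $ u $ v = f u * A $ u $ v * g v"
  by (simp add: matrix_matrix_mult_def diag_def if_distrib if_distribR sum.delta sum.delta' cong: if_cong)

lemma laplacian_entry:
  fixes w :: "'v::finite \<Rightarrow> 'v \<Rightarrow> real"
  assumes "\<And>u. 0 < vweight k w u"
  shows "laplacian k w $ u $ v =
    combinatorial_laplacian w $ u $ v / (sqrt (vweight k w u) * sqrt (vweight k w v))"
  by (cases k) (simp_all add: normalized_laplacian_def diag_mult_mult_diag)

lemma combinatorial_laplacian_mult:
  fixes w :: "'v::finite \<Rightarrow> 'v \<Rightarrow> real"
  assumes "w u u = 0"
  shows "(\<Sum>v\<in>UNIV. combinatorial_laplacian w $ u $ v * y v) = (\<Sum>v\<in>UNIV. w u v * (y u - y v))"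
proof -
  have "(\<Sum>v\<in>UNIV. combinatorial_laplacian w $ u $ v * y v) =
      (\<Sum>v\<in>UNIV. (if v = u then wdegree w u * y u else 0) - w u v * y v)"
    by (intro sum.cong) (auto simp: combinatorial_laplacian_def assms)
  thus ?thesis
    by (simp add: sum_subtractf wdegree_def right_diff_distrib sum_distrib_right)
qed

text \<open>
  The eigenvalue equation of \<open>\<phi>\<close> at \<open>u\<close> expresses \<open>W $ u $ u\<close> through differences of \<open>\<phi>\<close>. Substituting
  this, \<open>\<phi> u * f u - \<phi> v * f v - (\<phi> u - \<phi> v) * f u = \<phi> v * (f u - f v)\<close> eliminates the potential.
\<close>

lemma ground_state_transform:
  fixes w :: "'v::finite \<Rightarrow> 'v \<Rightarrow> real" and f \<phi> :: "'v \<Rightarrow> real"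
  assumes loop: "\<And>u. w u u = 0" and dW: "diagonal_matrix W" and gs: "ground_state k w W \<phi>"
    and q: "\<And>u. 0 < vweight k w u"
  defines "H \<equiv> laplacian k w + W"
  defines "x \<equiv> \<chi> u. sqrt (vweight k w u) * \<phi> u * f u"
  shows "sqrt (vweight k w u) * \<phi> u * ((H *v x) $ u - nth_eigenvalue H 0 * x $ u) =
    (\<Sum>v\<in>UNIV. w u v * \<phi> u * \<phi> v * (f u - f v))"
proof -
  let ?q = "vweight k w"
  let ?l = "nth_eigenvalue H 0"
  have s0: "sqrt (?q u) \<noteq> 0" for u using q[of u] by simp
  have "sqrt (?q u) * (\<Sum>v\<in>UNIV. laplacian k w $ u $ v * x $ v) =
      (\<Sum>v\<in>UNIV. combinatorial_laplacian w $ u $ v * (\<phi> v * f v))"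
    unfolding sum_distrib_left using s0 q
    by (intro sum.cong) (simp_all add: x_def laplacian_entry field_simps)
  also have "\<dots> = (\<Sum>v\<in>UNIV. w u v * (\<phi> u * f u - \<phi> v * f v))"
    by (rule combinatorial_laplacian_mult) (rule loop)
  finally have L: "sqrt (?q u) * (\<Sum>v\<in>UNIV. laplacian k w $ u $ v * x $ v) =
    (\<Sum>v\<in>UNIV. w u v * (\<phi> u * f u - \<phi> v * f v))" .
  have W: "(\<Sum>v\<in>UNIV. W $ u $ v * x $ v) = W $ u $ u * x $ u"
  proof -
    have "(\<Sum>v\<in>UNIV. W $ u $ v * x $ v) = (\<Sum>v\<in>UNIV. if v = u then W $ u $ u * x $ u else 0)"
      using dW by (intro sum.cong) (auto simp: diagonal_matrix_def)
    thus ?thesis by simp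
  qed
  have Hx: "(H *v x) $ u = (\<Sum>v\<in>UNIV. laplacian k w $ u $ v * x $ v) + W $ u $ u * x $ u"
    by (simp add: H_def matrix_vector_mult_def distrib_right sum.distrib W)
  have sx: "sqrt (?q u) * x $ u = ?q u * \<phi> u * f u" using q[of u] by (simp add: x_def)
  have gsu: "(?l - W $ u $ u) * ?q u * \<phi> u = (\<Sum>v\<in>UNIV. w u v * (\<phi> u - \<phi> v))"
    using gs by (simp add: ground_state_def H_def)
  have "sqrt (?q u) * ((H *v x) $ u - ?l * x $ u) =
     (\<Sum>v\<in>UNIV. w u v * (\<phi> u * f u - \<phi> v * f v)) - (?l - W $ u $ u) * (sqrt (?q u) * x $ u)"
    unfolding Hx L[symmetric] by (simp add: algebra_simps)
  also have "(?l - W $ u $ u) * (sqrt (?q u) * x $ u) = (\<Sum>v\<in>UNIV. w u v * (\<phi> u - \<phi> v)) * f u"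
    unfolding sx gsu[symmetric] by simp
  also have "(\<Sum>v\<in>UNIV. w u v * (\<phi> u * f u - \<phi> v * f v)) - \<dots> = (\<Sum>v\<in>UNIV. w u v * \<phi> v * (f u - f v))"
    by (simp add: sum_distrib_right flip: sum_subtractf) (simp add: algebra_simps)
  finally have "\<phi> u * (sqrt (?q u) * ((H *v x) $ u - ?l * x $ u)) = \<phi> u * (\<Sum>v\<in>UNIV. w u v * \<phi> v * (f u - f v))"
    by simp
  thus ?thesis by (simp add: sum_distrib_left mult_ac)
qed

lemma transpose_stoquastic:
  fixes w :: "'v::finite \<Rightarrow> 'v \<Rightarrow> real"
  assumes "\<And>u v. w u v = w v u" "diagonal_matrix W" "\<And>u. 0 < vweight k w u"
  shows "transpose (laplacian k w + W) = laplacian k w + W"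
proof -
  have "W $ u $ v = W $ v $ u" for u v
    using assms(2) unfolding diagonal_matrix_def by metis
  thus ?thesis
    using assms(1) by (simp add: vec_eq_iff transpose_def laplacian_entry[OF assms(3)]
        combinatorial_laplacian_def mult.commute)
qed

lemma wdegree_le_degree_bound:
  fixes w :: "'v::finite \<Rightarrow> 'v \<Rightarrow> real"
  shows "wdegree w u \<le> degree_bound k w * vweight k w u"
  by (cases k) auto

text \<open>
  The difference between the degree-weighted squared norm and the left-hand side is the Dirichlet form
  of \<open>w\<close>, which is nonnegative.
\<close>

lemma weighted_pairing_le_degree_bound:
  fixes w :: "'v::finite \<Rightarrow> 'v \<Rightarrow> real"
  assumes sym: "\<And>u v. w u v = w v u" and nn: "\<And>u v. 0 \<le> w u v"
  shows "(\<Sum>u\<in>UNIV. \<Sum>v\<in>UNIV. w u v * x u * x v) \<le> degree_bound k w * (\<Sum>u\<in>UNIV. vweight k w u * (x u)\<^sup>2)"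
proof -
  have "0 \<le> dirichlet w x x" by (rule dirichlet_nonneg[OF nn])
  also have "\<dots> = (\<Sum>u\<in>UNIV. x u * (\<Sum>v\<in>UNIV. w u v * (x u - x v)))"
    using dirichlet_Green[of w x x] sym by simp
  also have "\<dots> = (\<Sum>u\<in>UNIV. wdegree w u * (x u)\<^sup>2) - (\<Sum>u\<in>UNIV. \<Sum>v\<in>UNIV. w u v * x u * x v)"
    by (simp add: wdegree_def sum_distrib_left sum_distrib_right algebra_simps power2_eq_square sum_subtractf)
  also have "(\<Sum>u\<in>UNIV. wdegree w u * (x u)\<^sup>2) \<le> (\<Sum>u\<in>UNIV. (degree_bound k w * vweight k w u) * (x u)\<^sup>2)"
    by (intro sum_mono mult_right_mono wdegree_le_degree_bound) auto
  finally show ?thesis by (simp add: sum_distrib_left mult_ac)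
qed

section \<open>The spectral gap\<close>

text \<open>
  By connectedness only constants have Dirichlet form 0. Through the transform this says that the
  lowest eigenvalue is simple, with eigenvector \<open>p u = sqrt (q u) * \<phi> u\<close>, and strictly below the minimum
  of the Rayleigh quotient on the orthogonal complement of \<open>p\<close>. Orthogonality to \<open>p\<close> is mean zero with
  respect to \<open>m\<close>.
\<close>

lemma spectral_gap_Rayleigh:
  fixes E :: "'v::finite set set" and w :: "'v \<Rightarrow> 'v \<Rightarrow> real" and W :: "real^'v^'v"
  assumes card: "CARD('v) \<ge> 2" and conn: "connected_graph E" and ew: "edge_weights E w"
    and loop: "\<And>u. w u u = 0" and dW: "diagonal_matrix W" and gs: "ground_state k w W \<phi>"
    and q: "\<And>u. 0 < vweight k w u"
  defines "H \<equiv> laplacian k w + W"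
  defines "\<gamma> \<equiv> nth_eigenvalue H 1 - nth_eigenvalue H 0"
  defines "c \<equiv> \<lambda>u v. w u v * \<phi> u * \<phi> v" and "m \<equiv> \<lambda>u. vweight k w u * (\<phi> u)\<^sup>2"
  shows "\<And>f. (\<Sum>u\<in>UNIV. m u * f u) = 0 \<Longrightarrow> \<gamma> * (\<Sum>u\<in>UNIV. m u * (f u)\<^sup>2) \<le> dirichlet c f f"
    and "\<exists>f u0. (\<Sum>u\<in>UNIV. m u * f u) = 0 \<and> f u0 \<noteq> 0 \<and>
      (\<forall>u. (\<Sum>v\<in>UNIV. c u v * (f u - f v)) = \<gamma> * m u * f u)"
proof -
  let ?q = "vweight k w" and ?a = "nth_eigenvalue H 0"
  define X where "X f = (\<chi> u. sqrt (?q u) * \<phi> u * f u)" for f :: "'v \<Rightarrow> real"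
  have \<phi>: "0 < \<phi> u" for u by (rule ground_state_pos[OF conn ew gs])
  have sq: "0 < sqrt (?q u)" for u using q[of u] by simp
  have w_sym: "w u v = w v u" for u v using ew by (simp add: edge_weights_def)
  have c_sym: "c u v = c v u" for u v using w_sym[of u v] by (simp add: c_def)
  have c_nn: "0 \<le> c u v" for u v
    using edge_weights_nonneg[OF ew, of u v] \<phi> by (simp add: c_def less_imp_le)
  have sym: "transpose H = H" unfolding H_def using w_sym dW q by (rule transpose_stoquastic)
  have key: "sqrt (?q u) * \<phi> u * ((H *v X f) $ u - ?a * X f $ u) = (\<Sum>v\<in>UNIV. c u v * (f u - f v))" for f u
    using ground_state_transform[OF loop dW gs q, of u f] unfolding X_def H_def c_def by simp
  have X_inner: "X f \<bullet> X g = (\<Sum>u\<in>UNIV. m u * f u * g u)" for f g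
    unfolding inner_vec_def
    using q by (intro sum.cong) (simp_all add: X_def m_def power2_eq_square less_imp_le)
  have form: "X f \<bullet> (H *v X f) - ?a * (X f \<bullet> X f) = dirichlet c f f" for f
  proof -
    have "X f \<bullet> (H *v X f) - ?a * (X f \<bullet> X f) = (\<Sum>u\<in>UNIV. X f $ u * ((H *v X f) $ u - ?a * X f $ u))"
      by (simp add: inner_vec_def sum_distrib_left algebra_simps sum_subtractf)
    also have "\<dots> = (\<Sum>u\<in>UNIV. f u * (\<Sum>v\<in>UNIV. c u v * (f u - f v)))"
      unfolding key[symmetric] by (intro sum.cong) (simp_all add: X_def)
    also have "\<dots> = dirichlet c f f" by (rule dirichlet_Green) (rule c_sym)
    finally show ?thesis .
  qed
  have X_surj: "\<exists>f. x = X f" for x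
    by (rule exI[of _ "\<lambda>u. x $ u / (sqrt (?q u) * \<phi> u)"])
      (use \<phi> sq in \<open>simp add: X_def vec_eq_iff less_imp_neq[symmetric]\<close>)
  have const: "f u = f v" if "dirichlet c f f = 0" for f u v
  proof (rule connected_graph_propagate[OF conn, of "\<lambda>v. f u = f v" u])
    fix a b assume "{a, b} \<in> E" "f u = f a"
    moreover have "0 < c a b" using ew \<phi> calculation by (auto simp: c_def edge_weights_def)
    ultimately show "f u = f b" using dirichlet_eq_0D[OF c_nn that] by metis
  qed simp
  define p where "p = X (\<lambda>_. 1)"
  have p_nz: "p \<noteq> 0" using \<phi> sq by (simp add: p_def X_def vec_eq_iff less_imp_neq[symmetric])
  have pX: "p \<bullet> X f = (\<Sum>u\<in>UNIV. m u * f u)" for f by (simp add: p_def X_inner)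
  have p_ev: "H *v p = ?a *\<^sub>R p"
  proof -
    have "(H *v p) $ u = ?a * p $ u" for u
      using key[of u "\<lambda>_. 1"] \<phi>[of u] sq[of u] unfolding p_def by simp
    thus ?thesis by (simp add: vec_eq_iff)
  qed
  have simple: "eigenspace H ?a = span {p}"
  proof
    show "eigenspace H ?a \<subseteq> span {p}"
    proof
      fix x assume x: "x \<in> eigenspace H ?a"
      obtain f where f: "x = X f" using X_surj by auto
      have "dirichlet c f f = 0" using form[of f] x f by (simp add: eigenspace_def)
      hence "f u = f undefined" for u by (rule const)
      hence "x = f undefined *\<^sub>R p" unfolding f p_def X_def by (simp add: vec_eq_iff mult_ac)
      thus "x \<in> span {p}" by (simp add: span_base span_scale)
    qed
    show "span {p} \<subseteq> eigenspace H ?a"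
      using p_ev by (auto simp: span_singleton eigenspace_def matrix_vector_mult_scaleR)
  qed
  obtain b y where y: "y \<noteq> 0" "H *v y = b *\<^sub>R y" "p \<bullet> y = 0"
    and low: "\<And>x. p \<bullet> x = 0 \<Longrightarrow> b * (x \<bullet> x) \<le> x \<bullet> (H *v x)"
    using exists_min_eigenvector_orthogonal[OF sym p_ev card] by metis
  obtain f where f: "y = X f" using X_surj by auto
  have mean: "(\<Sum>u\<in>UNIV. m u * f u) = 0" using y f pX by simp
  obtain u0 where u0: "f u0 \<noteq> 0"
    using y(1) unfolding f X_def by (auto simp: vec_eq_iff)
  have ab: "?a < b"
  proof (rule ccontr)
    assume "\<not> ?thesis"
    hence "dirichlet c f f \<le> 0" using form[of f] y f mult_nonpos_nonneg[of "b - ?a" "X f \<bullet> X f"]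
      by (simp flip: left_diff_distrib)
    hence "dirichlet c f f = 0" using dirichlet_nonneg[where c=c and f=f, OF c_nn] by linarith
    hence "f u = f u0" for u by (rule const)
    hence "(\<Sum>u\<in>UNIV. m u * f u) = (\<Sum>u\<in>UNIV. m u * f u0)"
      by (intro sum.cong refl arg_cong[where f="(*) (m _)"])
    hence "(\<Sum>u\<in>UNIV. m u) * f u0 = 0" using mean by (simp add: sum_distrib_right)
    moreover have "0 < (\<Sum>u\<in>UNIV. m u)" unfolding m_def using q \<phi> by (intro sum_pos mult_pos_pos zero_less_power) auto
    ultimately show False using u0 by simp
  qed
  have "nth_eigenvalue H 1 = b" by (rule nth_eigenvalue_1_eq[OF sym p_nz simple y(1,2) ab low])
  hence \<gamma>: "\<gamma> = b - ?a" by (simp add: \<gamma>_def)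
  show "\<gamma> * (\<Sum>u\<in>UNIV. m u * (g u)\<^sup>2) \<le> dirichlet c g g" if "(\<Sum>u\<in>UNIV. m u * g u) = 0" for g
    using low[of "X g"] form[of g] that pX[of g] X_inner[of g g]
    by (simp add: \<gamma> algebra_simps power2_eq_square)
  have "(\<Sum>v\<in>UNIV. c u v * (f u - f v)) = \<gamma> * m u * f u" for u
  proof -
    have "(\<Sum>v\<in>UNIV. c u v * (f u - f v)) = sqrt (?q u) * \<phi> u * (b * X f $ u - ?a * X f $ u)"
      using key[of u f] y(2) f by simp
    also have "\<dots> = \<gamma> * ((sqrt (?q u) * sqrt (?q u)) * (\<phi> u)\<^sup>2) * f u"
      by (simp add: X_def \<gamma> algebra_simps power2_eq_square)
    finally show ?thesis using q[of u] by (simp add: m_def)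
  qed
  thus "\<exists>f u0. (\<Sum>u\<in>UNIV. m u * f u) = 0 \<and> f u0 \<noteq> 0 \<and>
      (\<forall>u. (\<Sum>v\<in>UNIV. c u v * (f u - f v)) = \<gamma> * m u * f u)"
    using mean u0 by blast
qed

theorem mainTheorem1:
  fixes E :: "'v::finite set set"
    and w :: "'v \<Rightarrow> 'v \<Rightarrow> real"
    and k :: laplacian_kind
    and W H :: "real^'v^'v"
    and \<phi> :: "'v \<Rightarrow> real"
    and \<gamma> h Q :: real
  assumes "CARD('v) \<ge> 2"
    and "simple_graph E"
    and "connected_graph E"
    and "edge_weights E w"
    and "diagonal_matrix W"
    and "H = laplacian k w + W"
    and "\<gamma> = nth_eigenvalue H 1 - nth_eigenvalue H 0"
    and "ground_state k w W \<phi>"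
    and "h = cheeger_constant k w \<phi>"
    and "Q = degree_bound k w"
  shows "2 * h \<ge> \<gamma> \<and> \<gamma> \<ge> sqrt (h\<^sup>2 + Q\<^sup>2) - Q"
proof -
  note ew = assms(4)
  define c where "c u v = w u v * \<phi> u * \<phi> v" for u v
  define m where "m u = vweight k w u * (\<phi> u)\<^sup>2" for u
  have w_sym: "w u v = w v u" for u v using ew by (simp add: edge_weights_def)
  have w_nn: "0 \<le> w u v" for u v by (rule edge_weights_nonneg[OF ew])
  have "{u, u} \<notin> E" for u using assms(2) by (auto simp: simple_graph_def)
  hence loop: "w u u = 0" for u using ew by (simp add: edge_weights_def)
  have d: "0 < wdegree w u" for u by (rule wdegree_pos[OF assms(3) ew assms(1)])
  have q: "0 < vweight k w u" for u using d by (cases k) auto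
  have \<phi>: "0 < \<phi> u" for u by (rule ground_state_pos[OF assms(3) ew assms(8)])
  have m: "0 < m u" for u unfolding m_def using q[of u] \<phi>[of u] by (intro mult_pos_pos zero_less_power)
  have c_sym: "c u v = c v u" for u v using w_sym[of u v] by (simp add: c_def)
  have c_nn: "0 \<le> c u v" for u v using w_nn[of u v] \<phi> by (simp add: c_def less_imp_le)

  have Rayleigh: "\<gamma> * (\<Sum>u\<in>UNIV. m u * (f u)\<^sup>2) \<le> dirichlet c f f"
    if "(\<Sum>u\<in>UNIV. m u * f u) = 0" for f
    using spectral_gap_Rayleigh(1)[OF assms(1,3) ew loop assms(5,8) q, of f] that
    unfolding assms(6,7) c_def[abs_def] m_def[abs_def] by simp
  obtain f u0 where f: "(\<Sum>u\<in>UNIV. m u * f u) = 0" "f u0 \<noteq> 0"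
    "\<And>u. (\<Sum>v\<in>UNIV. c u v * (f u - f v)) = \<gamma> * m u * f u"
    using spectral_gap_Rayleigh(2)[OF assms(1,3) ew loop assms(5,8) q]
    unfolding assms(6,7) c_def[abs_def] m_def[abs_def] by blast

  define R where "R S = (\<Sum>u\<in>S. \<Sum>v\<in>-S. c u v) / min (sum m S) (sum m (-S))" for S
  define F where "F = {S :: 'v set. S \<noteq> {} \<and> S \<subset> UNIV}"
  have h: "h = Min (R ` F)"
    unfolding assms(9) cheeger_constant_def R_def F_def boundary_weight_def vol_def c_def m_def ..
  have "{undefined :: 'v} \<noteq> UNIV"
  proof
    assume "{undefined :: 'v} = UNIV"
    hence "CARD('v) = card {undefined :: 'v}" by (rule arg_cong[OF sym])
    thus False using assms(1) by simp
  qed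
  hence "{undefined} \<in> F" by (auto simp: F_def)
  hence F: "R ` F \<noteq> {}" "finite (R ` F)" by auto
  obtain S where S: "S \<in> F" "h = R S" using Min_in[OF F(2,1)] h by auto
  have min_pos: "0 < min (sum m S) (sum m (-S))" if "S \<noteq> {}" "S \<noteq> UNIV" for S
    using that m by (auto intro!: sum_pos)
  have upper: "\<gamma> \<le> 2 * h"
    unfolding S R_def
    by (rule Cheeger_upper) (use m S c_sym c_nn Rayleigh in \<open>auto simp: F_def\<close>)

  have h0: "0 \<le> h"
    unfolding S R_def using c_nn min_pos[of S] S by (intro divide_nonneg_pos sum_nonneg) (auto simp: F_def)
  have cut: "h * min (sum m S) (sum m (-S)) \<le> (\<Sum>u\<in>S. \<Sum>v\<in>-S. c u v)" if "S \<noteq> {}" "S \<noteq> UNIV" for S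
  proof -
    have "h \<le> R S" unfolding h using that F by (intro Min_le) (auto simp: F_def)
    thus ?thesis using min_pos[OF that] by (simp add: R_def pos_le_divide_eq)
  qed
  have Q0: "0 \<le> Q"
    using wdegree_le_degree_bound[of w undefined k] d[of undefined] q[of undefined] assms(10)
    by (metis less_le_trans less_imp_le zero_less_mult_pos2)
  have Q: "(\<Sum>u\<in>UNIV. \<Sum>v\<in>UNIV. c u v * g u * g v) \<le> Q * (\<Sum>u\<in>UNIV. m u * (g u)\<^sup>2)" for g
    using weighted_pairing_le_degree_bound[where w=w and x="\<lambda>u. \<phi> u * g u" and k=k, OF w_sym w_nn]
    unfolding assms(10) by (simp add: c_def m_def power_mult_distrib mult_ac)
  note lower = Cheeger_lower[OF c_sym c_nn m cut h0 Q0 Q f(3,1,2)]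
  have "sqrt (h\<^sup>2 + Q\<^sup>2) \<le> \<gamma> + Q"
    using lower Q0 by (intro real_le_lsqrt) (auto simp: power2_eq_square algebra_simps)
  thus ?thesis using upper by simp
qed

end
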